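(* Let $\{A(t)\}_{t\ge 0}$ be a continuous time chain of $N\times N$ matrices and let $\mathcal H_1(\mathcal V,\mathcal E_1)$ be its unbounded interactions graph. Then $\mathbf{rank}(A)$ is greater than or equal to the size of the smallest s-root of $\mathcal H_1(\mathcal V,\mathcal E_1)$.
   Context: Let $\mathcal V=\{1,\dots,N\}$. A continuous time chain $\{A(t)\}_{t\ge0}$ is a family of real $N\times N$ matrices $A(t)=(a_{ij}(t))$ with zero row sums and non-negative off-diagonal entries, whose entries are measurable and locally integrable functions of $t\in[0,\infty)$. Let $\Phi(t,\tau)$, $t\ge\tau\ge0$, be the state transition matrix of $\dot x(t)=A(t)x(t)$, so $x(t)=\Phi(t,\tau)x(\tau)$; it is invertible and row-stochastic. Rank: for $\tau\ge0$ let $\mathbf{null}_\tau(A)=\{v\in\mathbb R^N : \lim_{t\to\infty}\Phi(t,\tau)v=\mathbf 0_N\}$. This is a vector space whose dimension does not depend on $\tau$; this dimension is $\mathbf{nullity}(A)$, and $\mathbf{rank}(A)=N-\mathbf{nullity}(A)$. Unbounded interactions graph: the directed graph $\mathcal H_1(\mathcal V,\mathcal E_1)$ on $\mathcal V$ in which, for distinct $i,j\in\mathcal V$, $(i,j)\in\mathcal E_1$ (a link from $i$ to $j$) if and only if $\int_0^\infty a_{ji}(t)\,dt=\infty$. s-root: a subset $\mathcal S'\subset\mathcal V$ such that for every $i\in\mathcal V$, either $i\in\mathcal S'$ or there is $j\in\mathcal S'$ such that $i$ is reachable from $j$ by a directed path in $\mathcal H_1$. *)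

theory Defs
  imports "HOL-Analysis.Analysis"
begin

text \<open>
  Integrability on every \<open>{0..T}\<close> in the sense of \<open>absolutely_integrable_on\<close> includes Lebesgue
  measurability of the entries.
\<close>

definition continuous_time_chain :: "(real \<Rightarrow> real ^ 'n ^ 'n) \<Rightarrow> bool" where
  "continuous_time_chain A \<longleftrightarrow>
     (\<forall>i j. \<forall>T\<ge>0. (\<lambda>t. A t $ i $ j) absolutely_integrable_on {0..T}) \<and>
     (\<forall>t\<ge>0. \<forall>i. (\<Sum>j\<in>UNIV. A t $ i $ j) = 0) \<and>
     (\<forall>t\<ge>0. \<forall>i j. i \<noteq> j \<longrightarrow> 0 \<le> A t $ i $ j)"

text \<open>
  Since \<open>A\<close> is only locally integrable, \<open>x' = A x\<close> is understood in the Caratheodory sense, i.e. in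
  integrated form.
\<close>

definition is_solution :: "(real \<Rightarrow> real ^ 'n ^ 'n) \<Rightarrow> real \<Rightarrow> (real \<Rightarrow> real ^ 'n) \<Rightarrow> bool" where
  "is_solution A \<tau> x \<longleftrightarrow>
     (\<forall>t\<ge>\<tau>. (\<lambda>s. A s *v x s) absolutely_integrable_on {\<tau>..t} \<and>
             x t = x \<tau> + integral {\<tau>..t} (\<lambda>s. A s *v x s))"

text \<open>
  For a chain and \<open>t \<ge> \<tau> \<ge> 0\<close> the matrix below exists and is unique, because every initial vector at
  time \<open>\<tau>\<close> has exactly one solution on \<open>{\<tau>..}\<close>, depending linearly on it.
\<close>

definition state_transition :: "(real \<Rightarrow> real ^ 'n ^ 'n) \<Rightarrow> real \<Rightarrow> real \<Rightarrow> real ^ 'n ^ 'n" where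
  "state_transition A t \<tau> = (THE M. \<forall>x. is_solution A \<tau> x \<longrightarrow> x t = M *v x \<tau>)"

definition null_space :: "(real \<Rightarrow> real ^ 'n ^ 'n) \<Rightarrow> real \<Rightarrow> (real ^ 'n) set" where
  "null_space A \<tau> = {v. ((\<lambda>t. state_transition A t \<tau> *v v) \<longlongrightarrow> 0) at_top}"

text \<open>
  The dimension of \<open>null_space A \<tau>\<close> is the same for all \<open>\<tau> \<ge> 0\<close>, as \<open>state_transition A \<tau> 0\<close> is an
  invertible matrix mapping \<open>null_space A 0\<close> onto \<open>null_space A \<tau>\<close>; hence the choice \<open>\<tau> = 0\<close>.
\<close>

definition nullity :: "(real \<Rightarrow> real ^ 'n ^ 'n) \<Rightarrow> nat" where
  "nullity A = dim (null_space A 0)"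

definition chain_rank :: "(real \<Rightarrow> real ^ 'n ^ 'n) \<Rightarrow> nat" where
  "chain_rank A = CARD('n) - nullity A"

text \<open>
  The link \<open>(i, j)\<close> goes from \<open>i\<close> to \<open>j\<close> and is governed by the entry \<open>A t $ j $ i\<close> (indices swapped).
  Off-diagonal entries of a chain are non-negative, so \<open>ennreal\<close> truncates nothing.
\<close>

definition unbounded_interactions :: "(real \<Rightarrow> real ^ 'n ^ 'n) \<Rightarrow> ('n \<times> 'n) set" where
  "unbounded_interactions A =
     {(i, j). i \<noteq> j \<and> (\<integral>\<^sup>+t\<in>{0..}. ennreal (A t $ j $ i) \<partial>lebesgue) = \<infinity>}"

definition s_root :: "('a \<times> 'a) set \<Rightarrow> 'a set \<Rightarrow> bool" where
  "s_root E S \<longleftrightarrow> (\<forall>i. i \<in> S \<or> (\<exists>j\<in>S. (j, i) \<in> E\<^sup>+))"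

end

theory Submission
  imports Defs
begin

text \<open>
  The strongly connected components of \<open>\<H>\<^sub>1\<close> without incoming links, say \<open>k\<close> of them, give an s-root
  of size \<open>k\<close> by choosing one vertex in each. The total weight entering such a component from
  outside is integrable, so from some time \<open>\<tau>\<close> on it is at most \<open>1/4\<close>. If a solution equals \<open>c\<close> on
  the component at time \<open>\<tau>\<close> and is bounded by \<open>\<bar>c\<bar>\<close> everywhere, then on the component it keeps at
  least half of its size forever. Hence a vector that is constant on each of the \<open>k\<close> components and
  zero elsewhere lies in the null space at time \<open>\<tau>\<close> only if it vanishes, and the null space has
  codimension at least \<open>k\<close> there. Backward uniqueness of solutions carries this over to time \<open>0\<close>.

  The coefficients are merely locally integrable, so no step differentiates a solution:
  Gronwall-type arguments are made on intervals of small integral and patched together, and the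
  minimum principle comes from a backward Gronwall argument at a point where the minimum is attained.
\<close>

subsection \<open>Gronwall lemmas for integrable coefficients\<close>

text \<open>The indefinite integral of \<open>f\<close> is uniformly continuous on the compact
  interval, so all sufficiently short subintervals satisfy the smallness condition, and Bolzano
  bisection glues them by \<open>trans\<close>. This replaces an explicit subdivision into finitely
  many pieces of small integral.\<close>

lemma short_interval_induct:
  fixes f :: "real \<Rightarrow> real" and P :: "real \<Rightarrow> real \<Rightarrow> bool"
  assumes "s \<le> t" "f integrable_on {s..t}" "\<epsilon> > 0"
    and trans: "\<And>a b c. s \<le> a \<Longrightarrow> a \<le> b \<Longrightarrow> b \<le> c \<Longrightarrow> c \<le> t \<Longrightarrow> P a b \<Longrightarrow> P b c \<Longrightarrow> P a c"
    and short: "\<And>a b. s \<le> a \<Longrightarrow> a \<le> b \<Longrightarrow> b \<le> t \<Longrightarrow> integral {a..b} f \<le> \<epsilon> \<Longrightarrow> P a b"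
  shows "P s t"
proof -
  let ?F = "\<lambda>r. integral {s..r} f"
  have cont: "continuous_on {s..t} ?F"
    by (rule indefinite_integral_continuous_1) fact
  then have "uniformly_continuous_on {s..t} ?F"
    by (simp add: compact_uniformly_continuous)
  then obtain d where d: "d > 0"
    "\<And>a b. a \<in> {s..t} \<Longrightarrow> b \<in> {s..t} \<Longrightarrow> dist b a < d \<Longrightarrow> dist (?F b) (?F a) < \<epsilon>"
    using \<open>\<epsilon> > 0\<close> unfolding uniformly_continuous_on_def by metis
  \<comment> \<open>The bounds \<open>s\<close> and \<open>t\<close> are packed into the predicate
    because the intervals around a point that Bolzano's rule considers may stick out of the original
    one.\<close>
  have "s \<le> s \<and> s \<le> t \<and> t \<le> t \<longrightarrow> P s t"
    using \<open>s \<le> t\<close>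
  proof (induct rule: Bolzano[where P = "\<lambda>a b. s \<le> a \<and> a \<le> b \<and> b \<le> t \<longrightarrow> P a b"])
    case (trans a b c)
    then show ?case using assms(4)[of a b c] by auto
  next
    case (local x)
    have "P a b" if ab: "s \<le> a" "a \<le> b" "b \<le> t" "b - a < d" for a b
    proof (rule short)
      have "?F a + integral {a..b} f = ?F b"
        using ab by (intro Henstock_Kurzweil_Integration.integral_combine
            integrable_on_subinterval[OF assms(2)]) auto
      moreover have "dist (?F b) (?F a) < \<epsilon>"
        using ab by (intro d(2)) (auto simp: dist_real_def)
      ultimately show "integral {a..b} f \<le> \<epsilon>"
        by (simp add: dist_real_def)
    qed (use ab in auto)
    then show ?case using d(1) by force
  qed
  then show ?thesis using \<open>s \<le> t\<close> by simp
qed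

lemma absolutely_integrable_mult_continuous:
  fixes b y :: "real \<Rightarrow> real"
  assumes "b absolutely_integrable_on {s..t}" "continuous_on {s..t} y"
  shows "(\<lambda>r. b r * y r) absolutely_integrable_on {s..t}"
proof -
  have "(\<lambda>r. y r * b r) absolutely_integrable_on {s..t}"
  proof (rule absolutely_integrable_bounded_measurable_product_real)
    show "y \<in> borel_measurable (lebesgue_on {s..t})"
      by (rule continuous_imp_measurable_on_sets_lebesgue) (use assms in auto)
    show "bounded (y ` {s..t})"
      using assms by (intro compact_imp_bounded compact_continuous_image) auto
  qed (use assms in auto)
  then show ?thesis by (simp add: mult.commute)
qed

text \<open>On a piece where \<open>b\<close> has integral at most 1/2 and \<open>y\<close> vanishes
  at the right end, the maximum of \<open>y\<close> is at most half of itself, hence zero. Vanishing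
  then passes from piece to piece, from right to left.\<close>

lemma gronwall_zero_backward:
  fixes b y :: "real \<Rightarrow> real"
  assumes "s \<le> t" and b: "b absolutely_integrable_on {s..t}" "\<And>r. r \<in> {s..t} \<Longrightarrow> 0 \<le> b r"
    and y: "continuous_on {s..t} y" "\<And>r. r \<in> {s..t} \<Longrightarrow> 0 \<le> y r"
    and le: "\<And>p q. s \<le> p \<Longrightarrow> p \<le> q \<Longrightarrow> q \<le> t \<Longrightarrow> y p \<le> y q + integral {p..q} (\<lambda>r. b r * y r)"
    and "y t = 0" and "p \<in> {s..t}"
  shows "y p = 0"
proof -
  have bi: "b integrable_on {s..t}" using b(1) by (rule set_lebesgue_integral_eq_integral)
  have "y t = 0 \<longrightarrow> (\<forall>p\<in>{s..t}. y p = 0)"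
  proof (rule short_interval_induct[where f = b and s = s and t = t and \<epsilon> = "1/2"
        and P = "\<lambda>s t. y t = 0 \<longrightarrow> (\<forall>p\<in>{s..t}. y p = 0)"])
    fix u v assume uv: "s \<le> u" "u \<le> v" "v \<le> t" and small: "integral {u..v} b \<le> 1/2"
    show "y v = 0 \<longrightarrow> (\<forall>p\<in>{u..v}. y p = 0)"
    proof
      assume "y v = 0"
      have sub: "{u..v} \<subseteq> {s..t}" using uv by auto
      obtain m where m: "m \<in> {u..v}" "\<And>r. r \<in> {u..v} \<Longrightarrow> y r \<le> y m"
        using continuous_attains_sup[of "{u..v}" y] continuous_on_subset[OF y(1) sub] uv by auto
      have sub': "{m..v} \<subseteq> {s..t}" using m uv by auto
      have "y m \<le> integral {m..v} (\<lambda>r. b r * y r)"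
        using le[of m v] m uv \<open>y v = 0\<close> by auto
      also have "\<dots> \<le> integral {m..v} (\<lambda>r. b r * y m)"
      proof (rule integral_le)
        show "(\<lambda>r. b r * y r) integrable_on {m..v}"
          by (intro set_lebesgue_integral_eq_integral(1) absolutely_integrable_mult_continuous
              absolutely_integrable_on_subinterval[OF b(1) sub'] continuous_on_subset[OF y(1) sub'])
        show "(\<lambda>r. b r * y m) integrable_on {m..v}"
          using integrable_on_subinterval[OF bi sub'] by (rule integrable_on_mult_left)
        show "b r * y r \<le> b r * y m" if "r \<in> {m..v}" for r
          using that m uv by (intro mult_left_mono m(2) b(2)) auto
      qed
      also have "\<dots> = integral {m..v} b * y m" by simp
      also have "\<dots> \<le> integral {u..v} b * y m"
        using sub sub' m uv by (intro mult_right_mono integral_subset_le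
            integrable_on_subinterval[OF bi]) (auto intro!: b(2) y(2))
      also have "\<dots> \<le> 1/2 * y m"
        using small m sub by (intro mult_right_mono y(2)) auto
      finally have "y m \<le> 0" by simp
      show "\<forall>p\<in>{u..v}. y p = 0"
      proof
        fix p assume p: "p \<in> {u..v}"
        show "y p = 0"
          using m(2)[OF p] \<open>y m \<le> 0\<close> y(2)[of p] p sub by auto
      qed
    qed
  next
    fix a c d assume "s \<le> a" "a \<le> c" "c \<le> d" "d \<le> t"
      and *: "y c = 0 \<longrightarrow> (\<forall>p\<in>{a..c}. y p = 0)" "y d = 0 \<longrightarrow> (\<forall>p\<in>{c..d}. y p = 0)"
    then show "y d = 0 \<longrightarrow> (\<forall>p\<in>{a..d}. y p = 0)"
      by (metis atLeastAtMost_iff nle_le)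
  qed (use \<open>s \<le> t\<close> bi in auto)
  then show ?thesis using assms by blast
qed

text \<open>The time reversal of the backward version: it is applied to the reflected functions on
  the reflected interval.\<close>

lemma gronwall_zero_forward:
  fixes b y :: "real \<Rightarrow> real"
  assumes "s \<le> t" and b: "b absolutely_integrable_on {s..t}" "\<And>r. r \<in> {s..t} \<Longrightarrow> 0 \<le> b r"
    and y: "continuous_on {s..t} y" "\<And>r. r \<in> {s..t} \<Longrightarrow> 0 \<le> y r"
    and le: "\<And>p q. s \<le> p \<Longrightarrow> p \<le> q \<Longrightarrow> q \<le> t \<Longrightarrow> y q \<le> y p + integral {p..q} (\<lambda>r. b r * y r)"
    and "y s = 0" and "p \<in> {s..t}"
  shows "y p = 0"
proof -
  have "y (- (- p)) = 0"
  proof (rule gronwall_zero_backward[where s = "-t" and t = "-s" and b = "\<lambda>r. b (- r)"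
        and y = "\<lambda>r. y (- r)" and p = "-p"])
    show "continuous_on {- t..- s} (\<lambda>r. y (- r))"
      by (rule continuous_on_compose2[OF y(1)]) (auto intro!: continuous_intros)
    fix p q assume "-t \<le> p" "p \<le> q" "q \<le> -s"
    then show "y (- p) \<le> y (- q) + integral {p..q} (\<lambda>r. b (- r) * y (- r))"
      using le[of "-q" "-p"] Henstock_Kurzweil_Integration.integral_reflect_real[of "-p" "-q" "\<lambda>r. b r * y r"] by simp
  qed (use assms in auto)
  then show ?thesis by simp
qed

subsection \<open>Linear differential equations in integrated form\<close>

definition entries_integrable :: "(real \<Rightarrow> real ^ 'n ^ 'm) \<Rightarrow> real \<Rightarrow> real \<Rightarrow> bool" where
  "entries_integrable A s t \<longleftrightarrow> (\<forall>i j. (\<lambda>r. A r $ i $ j) absolutely_integrable_on {s..t})"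

text \<open>The entrywise l1 norm: it dominates the operator norm, and its integrability along a
  chain follows at once from that of the entries.\<close>

definition entry_sum :: "real ^ 'n ^ 'm \<Rightarrow> real" where
  "entry_sum M = (\<Sum>i\<in>UNIV. \<Sum>j\<in>UNIV. \<bar>M $ i $ j\<bar>)"

text \<open>The version of \<open>is_solution\<close> on a compact interval, which can be restricted
  and glued.\<close>

definition solution_on :: "(real \<Rightarrow> real ^ 'n ^ 'n) \<Rightarrow> real \<Rightarrow> real \<Rightarrow> (real \<Rightarrow> real ^ 'n) \<Rightarrow> bool" where
  "solution_on A s t x \<longleftrightarrow>
     (\<lambda>q. A q *v x q) absolutely_integrable_on {s..t} \<and>
     (\<forall>r\<in>{s..t}. x r = x s + integral {s..r} (\<lambda>q. A q *v x q))"

lemma entry_sum_nonneg: "0 \<le> entry_sum M"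
  unfolding entry_sum_def by (intro sum_nonneg) auto

lemma norm_matrix_vector_mult_le: "norm (M *v x) \<le> entry_sum M * norm x"
proof -
  have "norm (M *v x) \<le> (\<Sum>i\<in>UNIV. \<bar>(M *v x) $ i\<bar>)" by (rule norm_le_l1_cart)
  also have "\<dots> \<le> (\<Sum>i\<in>UNIV. \<Sum>j\<in>UNIV. \<bar>M $ i $ j\<bar> * norm x)"
  proof (rule sum_mono)
    fix i
    have "\<bar>(M *v x) $ i\<bar> \<le> (\<Sum>j\<in>UNIV. \<bar>M $ i $ j * x $ j\<bar>)"
      by (simp add: matrix_vector_mult_def)
    also have "\<dots> \<le> (\<Sum>j\<in>UNIV. \<bar>M $ i $ j\<bar> * norm x)"
      by (intro sum_mono) (auto simp: abs_mult intro!: mult_left_mono component_le_norm_cart)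
    finally show "\<bar>(M *v x) $ i\<bar> \<le> (\<Sum>j\<in>UNIV. \<bar>M $ i $ j\<bar> * norm x)" .
  qed
  also have "\<dots> = entry_sum M * norm x"
    by (simp add: entry_sum_def sum_distrib_right)
  finally show ?thesis .
qed

lemma entries_integrable_subinterval:
  "entries_integrable A s t \<Longrightarrow> {u..v} \<subseteq> {s..t} \<Longrightarrow> entries_integrable A u v"
  unfolding entries_integrable_def by (meson absolutely_integrable_on_subinterval)

lemma entry_sum_integrable:
  assumes "entries_integrable A s t"
  shows "(\<lambda>r. entry_sum (A r)) absolutely_integrable_on {s..t}"
  using assms unfolding entry_sum_def entries_integrable_def
  by (intro absolutely_integrable_sum set_integrable_abs) auto

lemma matrix_vector_mult_integrable:
  fixes A :: "real \<Rightarrow> real ^ 'n ^ 'm"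
  assumes "entries_integrable A s t" "continuous_on {s..t} x"
  shows "(\<lambda>q. A q *v x q) absolutely_integrable_on {s..t}"
proof (rule absolutely_integrable_componentwise)
  fix b :: "real ^ 'm" assume "b \<in> Basis"
  then obtain i where "b = axis i 1" by (auto simp: Basis_vec_def)
  then have "(\<lambda>q. (A q *v x q) \<bullet> b) = (\<lambda>q. \<Sum>j\<in>UNIV. A q $ i $ j * x q $ j)"
    by (simp add: inner_axis matrix_vector_mult_def)
  moreover have "(\<lambda>q. \<Sum>j\<in>UNIV. A q $ i $ j * x q $ j) absolutely_integrable_on {s..t}"
    using assms unfolding entries_integrable_def
    by (intro absolutely_integrable_sum absolutely_integrable_mult_continuous
        continuous_on_component) auto
  ultimately show "(\<lambda>q. (A q *v x q) \<bullet> b) absolutely_integrable_on {s..t}"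
    by simp
qed

lemma solution_on_eq:
  "solution_on A s t x \<Longrightarrow> r \<in> {s..t} \<Longrightarrow> x r = x s + integral {s..r} (\<lambda>q. A q *v x q)"
  unfolding solution_on_def by blast

lemma solution_on_integrable:
  "solution_on A s t x \<Longrightarrow> (\<lambda>q. A q *v x q) integrable_on {s..t}"
  unfolding solution_on_def by (auto intro: set_lebesgue_integral_eq_integral)

lemma solution_on_continuous:
  assumes "solution_on A s t x"
  shows "continuous_on {s..t} x"
proof -
  have "continuous_on {s..t} (\<lambda>r. x s + integral {s..r} (\<lambda>q. A q *v x q))"
    by (intro continuous_intros indefinite_integral_continuous_1 solution_on_integrable[OF assms])
  then show ?thesis
    by (rule continuous_on_eq) (rule solution_on_eq[OF assms, symmetric])
qed

lemma solution_onI: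
  assumes "entries_integrable A s t" "continuous_on {s..t} x"
    and "\<And>r. r \<in> {s..t} \<Longrightarrow> x r = x s + integral {s..r} (\<lambda>q. A q *v x q)"
  shows "solution_on A s t x"
  using assms matrix_vector_mult_integrable unfolding solution_on_def by blast

lemma solution_on_increment:
  assumes "solution_on A s t x" "s \<le> p" "p \<le> q" "q \<le> t"
  shows "x q = x p + integral {p..q} (\<lambda>r. A r *v x r)"
proof -
  have "x q = x s + integral {s..q} (\<lambda>r. A r *v x r)"
    using assms by (intro solution_on_eq[OF assms(1)]) auto
  also have "integral {s..q} (\<lambda>r. A r *v x r)
      = integral {s..p} (\<lambda>r. A r *v x r) + integral {p..q} (\<lambda>r. A r *v x r)"
    using assms
    by (intro Henstock_Kurzweil_Integration.integral_combine[symmetric]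
        integrable_on_subinterval[OF solution_on_integrable]) auto
  also have "x s + \<dots> = (x s + integral {s..p} (\<lambda>r. A r *v x r)) + integral {p..q} (\<lambda>r. A r *v x r)"
    by (simp only: add.assoc)
  also have "x s + integral {s..p} (\<lambda>r. A r *v x r) = x p"
    using assms by (intro solution_on_eq[OF assms(1), symmetric]) auto
  finally show ?thesis .
qed

lemma solution_on_subinterval:
  assumes "solution_on A s t x" "s \<le> u" "v \<le> t"
  shows "solution_on A u v x"
proof -
  have "(\<lambda>q. A q *v x q) absolutely_integrable_on {u..v}"
    using assms absolutely_integrable_on_subinterval unfolding solution_on_def by fastforce
  then show ?thesis
    using assms unfolding solution_on_def[of A u v]
    by (intro conjI ballI solution_on_increment[OF assms(1)]) auto
qed

lemma solution_on_cong:
  assumes x: "solution_on A s t x" and eq: "\<And>r. r \<in> {s..t} \<Longrightarrow> x r = y r"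
  shows "solution_on A s t y"
  unfolding solution_on_def
proof (intro conjI ballI)
  have "(\<lambda>q. A q *v y q) absolutely_integrable_on {s..t} \<longleftrightarrow>
      (\<lambda>q. A q *v x q) absolutely_integrable_on {s..t}"
    using eq by (intro set_integrable_cong) auto
  then show "(\<lambda>q. A q *v y q) absolutely_integrable_on {s..t}"
    using x unfolding solution_on_def by blast
  fix r assume r: "r \<in> {s..t}"
  have "integral {s..r} (\<lambda>q. A q *v x q) = integral {s..r} (\<lambda>q. A q *v y q)"
    using r eq by (intro integral_cong) auto
  then show "y r = y s + integral {s..r} (\<lambda>q. A q *v y q)"
    using solution_on_eq[OF x r] eq[of r] eq[of s] r by simp
qed

lemma solution_on_lincomb:
  assumes "solution_on A s t x" "solution_on A s t y"
  shows "solution_on A s t (\<lambda>r. a *\<^sub>R x r + b *\<^sub>R y r)"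
proof -
  note xi = assms(1)[unfolded solution_on_def, THEN conjunct1]
  note yi = assms(2)[unfolded solution_on_def, THEN conjunct1]
  have eq: "A q *v (a *\<^sub>R x q + b *\<^sub>R y q) = a *\<^sub>R (A q *v x q) + b *\<^sub>R (A q *v y q)" for q
    by (simp add: matrix_vector_right_distrib matrix_vector_mult_scaleR)
  have "(\<lambda>q. A q *v (a *\<^sub>R x q + b *\<^sub>R y q)) absolutely_integrable_on {s..t}"
    unfolding eq using xi yi by (intro set_integral_add absolutely_integrable_scaleR_left)
  moreover have "a *\<^sub>R x r + b *\<^sub>R y r = a *\<^sub>R x s + b *\<^sub>R y s
      + integral {s..r} (\<lambda>q. A q *v (a *\<^sub>R x q + b *\<^sub>R y q))" if r: "r \<in> {s..t}" for r
  proof -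
    have "(\<lambda>q. A q *v x q) integrable_on {s..r}" "(\<lambda>q. A q *v y q) integrable_on {s..r}"
      using r assms by (auto intro!: integrable_on_subinterval[OF solution_on_integrable])
    then have "integral {s..r} (\<lambda>q. A q *v (a *\<^sub>R x q + b *\<^sub>R y q))
        = a *\<^sub>R integral {s..r} (\<lambda>q. A q *v x q) + b *\<^sub>R integral {s..r} (\<lambda>q. A q *v y q)"
      unfolding eq by (simp add: integral_add integrable_cmul)
    then show ?thesis
      by (subst solution_on_eq[OF assms(1) r], subst solution_on_eq[OF assms(2) r])
        (simp add: algebra_simps)
  qed
  ultimately show ?thesis unfolding solution_on_def by blast
qed

text \<open>The norm of \<open>x\<close> changes between two times by at most the integral of
  \<open>entry_sum\<close> times the norm, so both Gronwall lemmas apply. Since \<open>q\<close> may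
  lie on either side of \<open>p\<close>, this also yields backward uniqueness, which later makes
  the flow injective.\<close>

lemma solution_on_zero:
  assumes A: "entries_integrable A s t" and x: "solution_on A s t x"
    and "p \<in> {s..t}" "x p = 0" "q \<in> {s..t}"
  shows "x q = 0"
proof -
  note cont = solution_on_continuous[OF x]
  have incr: "norm (x v - x u) \<le> integral {u..v} (\<lambda>r. entry_sum (A r) * norm (x r))"
    if uv: "s \<le> u" "u \<le> v" "v \<le> t" for u v
  proof -
    have sub: "{u..v} \<subseteq> {s..t}" using uv by auto
    have "x v - x u = integral {u..v} (\<lambda>r. A r *v x r)"
      using solution_on_increment[OF x uv] by simp
    moreover have "norm (integral {u..v} (\<lambda>r. A r *v x r))
        \<le> integral {u..v} (\<lambda>r. entry_sum (A r) * norm (x r))"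
    proof (rule Henstock_Kurzweil_Integration.integral_norm_bound_integral)
      show "(\<lambda>r. A r *v x r) integrable_on {u..v}"
        using integrable_on_subinterval[OF solution_on_integrable[OF x] sub] .
      show "(\<lambda>r. entry_sum (A r) * norm (x r)) integrable_on {u..v}"
        by (intro set_lebesgue_integral_eq_integral(1) absolutely_integrable_mult_continuous
            absolutely_integrable_on_subinterval[OF entry_sum_integrable[OF A] sub]
            continuous_on_norm continuous_on_subset[OF cont sub])
    qed (rule norm_matrix_vector_mult_le)
    ultimately show ?thesis by simp
  qed
  have "norm (x q) = 0"
  proof (cases "q \<le> p")
    case True
    show ?thesis
    proof (rule gronwall_zero_backward[where s = s and t = p and y = "\<lambda>r. norm (x r)"
          and b = "\<lambda>r. entry_sum (A r)"])
      show "norm (x u) \<le> norm (x v) + integral {u..v} (\<lambda>r. entry_sum (A r) * norm (x r))"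
        if "s \<le> u" "u \<le> v" "v \<le> p" for u v
        using incr[of u v] that assms norm_triangle_ineq3[of "x v" "x u"] by auto
    qed (use True assms cont in \<open>auto intro!: entry_sum_integrable entry_sum_nonneg
        continuous_intros intro: entries_integrable_subinterval continuous_on_subset\<close>)
  next
    case False
    show ?thesis
    proof (rule gronwall_zero_forward[where s = p and t = t and y = "\<lambda>r. norm (x r)"
          and b = "\<lambda>r. entry_sum (A r)"])
      show "norm (x v) \<le> norm (x u) + integral {u..v} (\<lambda>r. entry_sum (A r) * norm (x r))"
        if "p \<le> u" "u \<le> v" "v \<le> t" for u v
        using incr[of u v] that assms norm_triangle_ineq3[of "x v" "x u"] by auto
    qed (use False assms cont in \<open>auto intro!: entry_sum_integrable entry_sum_nonneg
        continuous_intros intro: entries_integrable_subinterval continuous_on_subset\<close>)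
  qed
  then show ?thesis by simp
qed

lemma solution_on_unique:
  assumes "entries_integrable A s t" "solution_on A s t x" "solution_on A s t y"
    and "p \<in> {s..t}" "x p = y p" "q \<in> {s..t}"
  shows "x q = y q"
proof -
  have "1 *\<^sub>R x q + (- 1) *\<^sub>R y q = 0"
    by (rule solution_on_zero[OF assms(1) solution_on_lincomb[OF assms(2,3)] assms(4) _ assms(6)])
      (simp add: assms(5))
  then show ?thesis by simp
qed

section \<open>Existence of solutions on compact intervals\<close>

text \<open>Picard iteration: with an integral of at most 1/2, the integral operator is a
  contraction in the supremum norm, and its Banach fixed point is the solution.\<close>

lemma solution_on_exists_short:
  fixes A :: "real \<Rightarrow> real ^ 'n ^ 'n"
  assumes "s \<le> t" and A: "entries_integrable A s t"
    and small: "integral {s..t} (\<lambda>r. entry_sum (A r)) \<le> 1/2"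
  shows "\<exists>x. solution_on A s t x \<and> x s = v"
proof -
  \<comment> \<open>Clamping the time to the interval makes the Picard image bounded and continuous
    on the whole line, so that the iteration lives in the complete type of bounded continuous
    functions.\<close>
  let ?c = "\<lambda>r. max s (min t r)"
  define G where "G x r = v + integral {s..?c r} (\<lambda>q. A q *v x q)" for x :: "real \<Rightarrow> real ^ 'n" and r
  have Ax: "(\<lambda>q. A q *v apply_bcontfun x q) integrable_on {s..t}" for x :: "real \<Rightarrow>\<^sub>C (real ^ 'n)"
    by (intro set_lebesgue_integral_eq_integral(1) matrix_vector_mult_integrable[OF A]) auto
  have c: "?c r \<in> {s..t}" for r using \<open>s \<le> t\<close> by auto
  have G: "G (apply_bcontfun x) \<in> bcontfun" for x :: "real \<Rightarrow>\<^sub>C (real ^ 'n)"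
  proof -
    let ?h = "\<lambda>r. v + integral {s..r} (\<lambda>q. A q *v apply_bcontfun x q)"
    have h: "continuous_on {s..t} ?h"
      by (intro continuous_intros indefinite_integral_continuous_1 Ax)
    have "continuous_on UNIV (\<lambda>r. ?h (?c r))"
      by (rule continuous_on_compose2[OF h]) (use c in \<open>auto intro!: continuous_intros\<close>)
    moreover have "bounded (range (\<lambda>r. ?h (?c r)))"
      by (rule bounded_subset[OF compact_imp_bounded[OF compact_continuous_image[OF h]]])
        (use c in auto)
    ultimately show ?thesis by (simp add: bcontfun_def G_def[abs_def])
  qed
  define f where "f x = Bcontfun (G (apply_bcontfun x))" for x :: "real \<Rightarrow>\<^sub>C (real ^ 'n)"
  have f: "apply_bcontfun (f x) = G (apply_bcontfun x)" for x
    unfolding f_def by (rule Bcontfun_inverse[OF G])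
  note E = set_lebesgue_integral_eq_integral(1)[OF entry_sum_integrable[OF A]]
  have "dist (f x) (f y) \<le> 1/2 * dist x y" for x y
  proof (rule dist_bound)
    fix r
    have sub: "{s..?c r} \<subseteq> {s..t}" using c[of r] by auto
    have "dist (f x r) (f y r) = norm (integral {s..?c r} (\<lambda>q. A q *v x q)
        - integral {s..?c r} (\<lambda>q. A q *v y q))"
      by (simp add: f G_def dist_norm)
    also have "\<dots> = norm (integral {s..?c r} (\<lambda>q. A q *v (x q - y q)))"
      by (subst integral_diff[symmetric])
        (auto intro: integrable_on_subinterval[OF Ax sub] simp: matrix_vector_mult_diff_distrib)
    also have "\<dots> \<le> integral {s..?c r} (\<lambda>q. entry_sum (A q) * dist x y)"
    proof (rule Henstock_Kurzweil_Integration.integral_norm_bound_integral)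
      show "(\<lambda>q. A q *v (x q - y q)) integrable_on {s..?c r}"
        unfolding matrix_vector_mult_diff_distrib
        by (intro integrable_diff integrable_on_subinterval[OF Ax sub])
      show "(\<lambda>q. entry_sum (A q) * dist x y) integrable_on {s..?c r}"
        by (intro integrable_on_mult_left integrable_on_subinterval[OF E sub])
      fix q
      have "norm (A q *v (x q - y q)) \<le> entry_sum (A q) * dist (x q) (y q)"
        unfolding dist_norm by (rule norm_matrix_vector_mult_le)
      also have "\<dots> \<le> entry_sum (A q) * dist x y"
        by (intro mult_left_mono dist_bounded entry_sum_nonneg)
      finally show "norm (A q *v (x q - y q)) \<le> entry_sum (A q) * dist x y" .
    qed
    also have "\<dots> = integral {s..?c r} (\<lambda>q. entry_sum (A q)) * dist x y" by simp
    also have "\<dots> \<le> integral {s..t} (\<lambda>q. entry_sum (A q)) * dist x y"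
      by (intro mult_right_mono integral_subset_le integrable_on_subinterval[OF E] sub)
        (auto simp: entry_sum_nonneg)
    also have "\<dots> \<le> 1/2 * dist x y"
      using small by (intro mult_right_mono) auto
    finally show "dist (f x r) (f y r) \<le> 1/2 * dist x y" .
  qed
  then obtain x where x: "f x = x"
    using banach_fix_type[of "1/2" f] by auto
  have xr: "apply_bcontfun x r = v + integral {s..r} (\<lambda>q. A q *v x q)" if "r \<in> {s..t}" for r
    using f[of x, unfolded x, THEN fun_cong, of r] that by (auto simp: G_def)
  have "x s = v" using xr[of s] \<open>s \<le> t\<close> by simp
  moreover have "solution_on A s t x"
    by (rule solution_onI[OF A]) (auto simp only: \<open>x s = v\<close> intro!: xr)
  ultimately show ?thesis by blast
qed

lemma solution_on_concat:
  assumes A: "entries_integrable A a c" and "a \<le> b" "b \<le> c"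
    and x: "solution_on A a b x" and y: "solution_on A b c y" and "x b = y b"
  shows "solution_on A a c (\<lambda>r. if r \<le> b then x r else y r)" (is "solution_on A a c ?z")
proof (rule solution_onI[OF A])
  have "{a..c} = {a..b} \<union> {b..c}" using assms by auto
  then show cont: "continuous_on {a..c} ?z"
    using solution_on_continuous[OF x] solution_on_continuous[OF y] \<open>x b = y b\<close>
    by (auto intro!: continuous_on_If)
  have zi: "(\<lambda>q. A q *v ?z q) integrable_on {a..c}"
    by (intro set_lebesgue_integral_eq_integral(1) matrix_vector_mult_integrable A cont)
  have left: "?z r = ?z a + integral {a..r} (\<lambda>q. A q *v ?z q)" if r: "a \<le> r" "r \<le> b" for r
  proof -
    have "integral {a..r} (\<lambda>q. A q *v ?z q) = integral {a..r} (\<lambda>q. A q *v x q)"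
      using r by (intro integral_cong) auto
    then show ?thesis using r solution_on_eq[OF x, of r] \<open>a \<le> b\<close> by simp
  qed
  fix r assume r: "r \<in> {a..c}"
  show "?z r = ?z a + integral {a..r} (\<lambda>q. A q *v ?z q)"
  proof (cases "r \<le> b")
    case True
    then show ?thesis using left[of r] r by auto
  next
    case False
    have "integral {a..r} (\<lambda>q. A q *v ?z q)
        = integral {a..b} (\<lambda>q. A q *v ?z q) + integral {b..r} (\<lambda>q. A q *v ?z q)"
      using False r \<open>a \<le> b\<close>
      by (intro Henstock_Kurzweil_Integration.integral_combine[symmetric] integrable_on_subinterval[OF zi]) auto
    also have "integral {b..r} (\<lambda>q. A q *v ?z q) = integral {b..r} (\<lambda>q. A q *v y q)"
      using \<open>x b = y b\<close> by (intro integral_cong) auto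
    also have "integral {b..r} (\<lambda>q. A q *v y q) = y r - y b"
      using solution_on_eq[OF y, of r] False r by simp
    finally show ?thesis
      using left[of b] False \<open>a \<le> b\<close> \<open>x b = y b\<close> by (simp add: algebra_simps)
  qed
qed

text \<open>Local solutions are glued by \<open>solution_on_concat\<close>. The initial vector is
  quantified inside the induction predicate, because the second piece must start where the first one
  ends.\<close>

lemma solution_on_exists:
  fixes A :: "real \<Rightarrow> real ^ 'n ^ 'n"
  assumes "s \<le> t" and A: "entries_integrable A s t"
  shows "\<exists>x. solution_on A s t x \<and> x s = v"
proof -
  have "\<forall>v. \<exists>x. solution_on A s t x \<and> x s = v"
  proof (rule short_interval_induct[where f = "\<lambda>r. entry_sum (A r)" and \<epsilon> = "1/2" and s = s and t = t
        and P = "\<lambda>s t. \<forall>v. \<exists>x. solution_on A s t x \<and> x s = v"])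
    show "(\<lambda>r. entry_sum (A r)) integrable_on {s..t}"
      by (intro set_lebesgue_integral_eq_integral(1) entry_sum_integrable A)
  next
    fix a b c assume abc: "s \<le> a" "a \<le> b" "b \<le> c" "c \<le> t"
      and ab: "\<forall>v. \<exists>x. solution_on A a b x \<and> x a = v"
      and bc: "\<forall>v. \<exists>x. solution_on A b c x \<and> x b = v"
    show "\<forall>v. \<exists>x. solution_on A a c x \<and> x a = v"
    proof
      fix v
      obtain x where x: "solution_on A a b x" "x a = v" using ab by blast
      obtain y where y: "solution_on A b c y" "y b = x b" using bc by blast
      have "solution_on A a c (\<lambda>r. if r \<le> b then x r else y r)"
        using abc x y by (intro solution_on_concat entries_integrable_subinterval[OF A]) auto
      then show "\<exists>x. solution_on A a c x \<and> x a = v"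
        using x abc by (intro exI[of _ "\<lambda>r. if r \<le> b then x r else y r"]) auto
    qed
  next
    fix a b assume "s \<le> a" "a \<le> b" "b \<le> t" "integral {a..b} (\<lambda>r. entry_sum (A r)) \<le> 1/2"
    then show "\<forall>v. \<exists>x. solution_on A a b x \<and> x a = v"
      using solution_on_exists_short entries_integrable_subinterval[OF A, of a b] by auto
  qed (use \<open>s \<le> t\<close> in auto)
  then show ?thesis by blast
qed

section \<open>Solutions on half-lines and the transition matrix\<close>

lemma is_solution_iff: "is_solution A \<tau> x \<longleftrightarrow> (\<forall>t\<ge>\<tau>. solution_on A \<tau> t x)"
  unfolding is_solution_def solution_on_def by (meson atLeastAtMost_iff order_refl)

text \<open>By uniqueness, the solutions chosen on the intervals from \<tau> to \<open>t\<close>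
  agree where they overlap, so the diagonal \<open>X r r\<close> is one solution for all
  times.\<close>

lemma is_solution_exists:
  fixes A :: "real \<Rightarrow> real ^ 'n ^ 'n"
  assumes A: "\<And>t. entries_integrable A \<tau> t"
  shows "\<exists>x. is_solution A \<tau> x \<and> x \<tau> = v"
proof -
  have "\<forall>t\<in>{\<tau>..}. \<exists>x. solution_on A \<tau> t x \<and> x \<tau> = v"
    using solution_on_exists[OF _ A] by auto
  then obtain X where "\<forall>t\<in>{\<tau>..}. solution_on A \<tau> t (X t) \<and> X t \<tau> = v"
    unfolding bchoice_iff ..
  then have X: "\<And>t. t \<ge> \<tau> \<Longrightarrow> solution_on A \<tau> t (X t)" "\<And>t. t \<ge> \<tau> \<Longrightarrow> X t \<tau> = v"
    by auto
  have "solution_on A \<tau> t (\<lambda>r. X r r)" if t: "\<tau> \<le> t" for t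
  proof -
    have "X r r = X t r" if r: "r \<in> {\<tau>..t}" for r
    proof (rule solution_on_unique[OF A[of r], where x = "X r" and y = "X t" and p = \<tau> and q = r])
      show "solution_on A \<tau> r (X r)" using X r by simp
      show "solution_on A \<tau> r (X t)"
        by (rule solution_on_subinterval[OF X(1)[OF t]]) (use r in auto)
      show "X r \<tau> = X t \<tau>" using X r t by simp
    qed (use r in auto)
    then show ?thesis
      by (intro solution_on_cong[OF X(1)[OF t]]) simp
  qed
  then show ?thesis
    using X(2)[of \<tau>] by (intro exI[of _ "\<lambda>r. X r r"]) (auto simp: is_solution_iff)
qed

lemma is_solution_unique:
  assumes A: "\<And>t. entries_integrable A \<tau> t"
    and "is_solution A \<tau> x" "is_solution A \<tau> y" "x p = y p" "\<tau> \<le> p" "\<tau> \<le> q"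
  shows "x q = y q"
proof (rule solution_on_unique[OF A[of "max p q"], where x = x and y = y and p = p and q = q])
  show "solution_on A \<tau> (max p q) x" "solution_on A \<tau> (max p q) y"
    using assms by (auto simp: is_solution_iff)
qed (use assms in auto)

lemma is_solution_lincomb:
  assumes "is_solution A \<tau> x" "is_solution A \<tau> y"
  shows "is_solution A \<tau> (\<lambda>r. a *\<^sub>R x r + b *\<^sub>R y r)"
  using assms solution_on_lincomb unfolding is_solution_iff by blast

text \<open>This discharges the definite description in \<open>state_transition\<close>. By
  uniqueness the value at time \<open>t\<close> depends linearly on the initial vector, which gives
  the matrix; it is the only one because every vector is the initial value of some solution.\<close>

lemma state_transition_solution:
  fixes A :: "real \<Rightarrow> real ^ 'n ^ 'n"
  assumes A: "\<And>t. entries_integrable A \<tau> t" and "\<tau> \<le> t" and x: "is_solution A \<tau> x"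
  shows "state_transition A t \<tau> *v x \<tau> = x t"
proof -
  have "\<forall>v. \<exists>x. is_solution A \<tau> x \<and> x \<tau> = v"
    using is_solution_exists[OF A] by blast
  then obtain X where X: "\<And>v. is_solution A \<tau> (X v)" "\<And>v. X v \<tau> = v"
    unfolding choice_iff by blast
  have lincomb: "X (a *\<^sub>R u + b *\<^sub>R v) t = a *\<^sub>R X u t + b *\<^sub>R X v t" for a b u v
    by (rule is_solution_unique[OF A X(1) is_solution_lincomb[OF X(1) X(1)], where p = \<tau>])
      (use X(2) \<open>\<tau> \<le> t\<close> in auto)
  have "linear (\<lambda>v. X v t)"
    using lincomb[of 1 _ 1] lincomb[of _ _ 0] by (intro linearI) auto
  then have M: "matrix (\<lambda>v. X v t) *v v = X v t" for v
    by (rule matrix_works[OF linear_matrix_vector_mul_eq[THEN iffD2]])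
  have "\<forall>x. is_solution A \<tau> x \<longrightarrow> x t = state_transition A t \<tau> *v x \<tau>"
    unfolding state_transition_def
  proof (rule theI)
    show "\<forall>y. is_solution A \<tau> y \<longrightarrow> y t = matrix (\<lambda>v. X v t) *v y \<tau>"
    proof (intro allI impI)
      fix y assume y: "is_solution A \<tau> y"
      show "y t = matrix (\<lambda>v. X v t) *v y \<tau>"
        unfolding M by (rule is_solution_unique[OF A y X(1), where p = \<tau>]) (use X(2) \<open>\<tau> \<le> t\<close> in auto)
    qed
    fix N assume N: "\<forall>y. is_solution A \<tau> y \<longrightarrow> y t = N *v y \<tau>"
    show "N = matrix (\<lambda>v. X v t)"
      unfolding matrix_eq M using N X by metis
  qed
  then show ?thesis using x by simp
qed

subsection \<open>Minimum principle and persistence\<close>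

text \<open>The increments are only bounded from below, and \<open>C\<close> is arbitrary, so that
  the principle covers both full solutions and solutions restricted to a component and corrected for
  inflow.\<close>

lemma minimum_principle:
  fixes z :: "'i \<Rightarrow> real \<Rightarrow> real" and a :: "'i \<Rightarrow> 'i \<Rightarrow> real \<Rightarrow> real"
  assumes "finite C" "s \<le> t"
    and a: "\<And>i j. i \<in> C \<Longrightarrow> j \<in> C \<Longrightarrow> i \<noteq> j \<Longrightarrow> a i j absolutely_integrable_on {s..t}"
    and nonneg: "\<And>i j r. i \<in> C \<Longrightarrow> j \<in> C \<Longrightarrow> i \<noteq> j \<Longrightarrow> r \<in> {s..t} \<Longrightarrow> 0 \<le> a i j r"
    and z: "\<And>i. i \<in> C \<Longrightarrow> continuous_on {s..t} (z i)"
    and incr: "\<And>i p q. i \<in> C \<Longrightarrow> s \<le> p \<Longrightarrow> p \<le> q \<Longrightarrow> q \<le> t \<Longrightarrow>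
      z i p + integral {p..q} (\<lambda>r. \<Sum>j\<in>C - {i}. a i j r * (z j r - z i r)) \<le> z i q"
    and init: "\<And>i. i \<in> C \<Longrightarrow> m \<le> z i s"
    and "i \<in> C" "q \<in> {s..t}"
  shows "m \<le> z i q"
proof -
  have "\<exists>r\<in>{s..t}. \<forall>q\<in>{s..t}. z i r \<le> z i q" if "i \<in> C" for i
    using z[OF that] \<open>s \<le> t\<close> by (intro continuous_attains_inf) auto
  then obtain R where R: "\<And>i. i \<in> C \<Longrightarrow> R i \<in> {s..t}"
    "\<And>i q. i \<in> C \<Longrightarrow> q \<in> {s..t} \<Longrightarrow> z i (R i) \<le> z i q"
    by metis
  have "Min ((\<lambda>i. z i (R i)) ` C) \<in> (\<lambda>i. z i (R i)) ` C"
    using \<open>finite C\<close> \<open>i \<in> C\<close> by (intro Min_in) auto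
  \<comment> \<open>Integrating backwards from its minimum \<open>\<mu>\<close> at time \<open>R k\<close>, \<open>z k\<close> cannot have been above \<open>\<mu>\<close>
    at time \<open>s\<close>, so \<open>\<mu>\<close> is an initial value.\<close>
  then obtain k where k: "k \<in> C" "Min ((\<lambda>i. z i (R i)) ` C) = z k (R k)" by auto
  define \<mu> where "\<mu> = z k (R k)"
  have \<mu>: "\<mu> \<le> z j r" if "j \<in> C" "r \<in> {s..t}" for j r
  proof -
    have "\<mu> \<le> z j (R j)"
      unfolding \<mu>_def k(2)[symmetric] using \<open>finite C\<close> that by (intro Min_le) auto
    also have "\<dots> \<le> z j r" using R(2) that by blast
    finally show ?thesis .
  qed
  define b where "b r = (\<Sum>j\<in>C - {k}. a k j r)" for r
  have sub: "{s..R k} \<subseteq> {s..t}" using R(1)[OF k(1)] by auto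
  have bi: "b absolutely_integrable_on {s..t}"
    unfolding b_def[abs_def] using \<open>finite C\<close> k(1) by (intro absolutely_integrable_sum a) auto
  have "z k s - \<mu> = 0"
  proof (rule gronwall_zero_backward[where s = s and t = "R k" and b = b and y = "\<lambda>r. z k r - \<mu>"])
    show "b absolutely_integrable_on {s..R k}"
      using bi sub by (rule absolutely_integrable_on_subinterval)
    show "0 \<le> b r" if "r \<in> {s..R k}" for r
      unfolding b_def using that sub k(1) by (intro sum_nonneg nonneg) auto
    show "continuous_on {s..R k} (\<lambda>r. z k r - \<mu>)"
      by (intro continuous_intros continuous_on_subset[OF z[OF k(1)] sub])
    show "0 \<le> z k r - \<mu>" if "r \<in> {s..R k}" for r
      using \<mu>[OF k(1), of r] that sub by auto
    fix p q assume pq: "s \<le> p" "p \<le> q" "q \<le> R k"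
    then have sub': "{p..q} \<subseteq> {s..t}" using sub by auto
    \<comment> \<open>Replacing each \<open>z j\<close> by its lower bound \<mu> leaves a drift that
      involves only \<open>z k r - \<mu>\<close>, which is the scalar inequality that the backward
      Gronwall lemma requires.\<close>
    have "- integral {p..q} (\<lambda>r. b r * (z k r - \<mu>)) = integral {p..q} (\<lambda>r. - (b r * (z k r - \<mu>)))"
      by simp
    also have "\<dots> \<le> integral {p..q} (\<lambda>r. \<Sum>j\<in>C - {k}. a k j r * (z j r - z k r))"
    proof (rule integral_le)
      have "(\<lambda>r. b r * (z k r - \<mu>)) integrable_on {p..q}"
        by (intro set_lebesgue_integral_eq_integral(1) absolutely_integrable_mult_continuous
            absolutely_integrable_on_subinterval[OF bi sub'] continuous_intros
            continuous_on_subset[OF z[OF k(1)] sub'])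
      then show "(\<lambda>r. - (b r * (z k r - \<mu>))) integrable_on {p..q}"
        by (rule integrable_neg)
      show "(\<lambda>r. \<Sum>j\<in>C - {k}. a k j r * (z j r - z k r)) integrable_on {p..q}"
        using \<open>finite C\<close> k(1)
        by (intro set_lebesgue_integral_eq_integral(1) absolutely_integrable_sum
            absolutely_integrable_mult_continuous absolutely_integrable_on_subinterval[OF a sub']
            continuous_intros continuous_on_subset[OF z sub']) auto
      fix r assume r: "r \<in> {p..q}"
      have "- (b r * (z k r - \<mu>)) = (\<Sum>j\<in>C - {k}. a k j r * (\<mu> - z k r))"
        by (simp add: b_def sum_distrib_right[symmetric]) (simp add: algebra_simps)
      also have "\<dots> \<le> (\<Sum>j\<in>C - {k}. a k j r * (z j r - z k r))"
        using r sub' k(1) by (intro sum_mono mult_left_mono nonneg diff_right_mono \<mu>) auto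
      finally show "- (b r * (z k r - \<mu>)) \<le> (\<Sum>j\<in>C - {k}. a k j r * (z j r - z k r))" .
    qed
    finally show "z k p - \<mu> \<le> z k q - \<mu> + integral {p..q} (\<lambda>r. b r * (z k r - \<mu>))"
      using incr[OF k(1), of p q] pq R(1)[OF k(1)] by auto
  qed (use R(1)[OF k(1)] in \<open>auto simp: \<mu>_def\<close>)
  then show ?thesis
    using init[OF k(1)] \<mu>[OF \<open>i \<in> C\<close> \<open>q \<in> {s..t}\<close>] by simp
qed

section \<open>Bounds for solutions of a chain\<close>

lemma chain_entries_integrable:
  assumes "continuous_time_chain A" "0 \<le> s"
  shows "entries_integrable A s t"
proof -
  have "entries_integrable A 0 (max 0 t)"
    using assms unfolding continuous_time_chain_def entries_integrable_def by simp
  then show ?thesis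
    by (rule entries_integrable_subinterval) (use assms in auto)
qed

lemma chain_nonneg: "continuous_time_chain A \<Longrightarrow> 0 \<le> t \<Longrightarrow> i \<noteq> j \<Longrightarrow> 0 \<le> A t $ i $ j"
  unfolding continuous_time_chain_def by blast

text \<open>Zero row sums allow \<open>x r $ i\<close> to be subtracted from every coordinate, which
  removes the diagonal entry, the only one that may be negative.\<close>

lemma chain_solution_increment:
  assumes A: "continuous_time_chain A" and x: "solution_on A s t x"
    and "0 \<le> s" "s \<le> p" "p \<le> q" "q \<le> t"
  shows "x q $ i = x p $ i + integral {p..q} (\<lambda>r. \<Sum>j\<in>UNIV - {i}. A r $ i $ j * (x r $ j - x r $ i))"
proof -
  have "x q $ i - x p $ i = integral {p..q} (\<lambda>r. A r *v x r) \<bullet> axis i 1"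
    using solution_on_increment[OF x assms(4-6)] by (simp add: inner_axis)
  also have "\<dots> = integral {p..q} (\<lambda>r. (A r *v x r) \<bullet> axis i 1)"
    using assms by (intro integral_component_eq[symmetric]
        integrable_on_subinterval[OF solution_on_integrable[OF x]]) auto
  also have "\<dots> = integral {p..q} (\<lambda>r. \<Sum>j\<in>UNIV - {i}. A r $ i $ j * (x r $ j - x r $ i))"
  proof (rule integral_cong)
    fix r assume "r \<in> {p..q}"
    then have 0: "(\<Sum>j\<in>UNIV. A r $ i $ j) = 0"
      using A assms unfolding continuous_time_chain_def by auto
    have "(A r *v x r) \<bullet> axis i 1 = (\<Sum>j\<in>UNIV. A r $ i $ j * x r $ j)"
      by (simp add: inner_axis matrix_vector_mult_def)
    also have "\<dots> = (\<Sum>j\<in>UNIV. A r $ i $ j * x r $ j) - (\<Sum>j\<in>UNIV. A r $ i $ j) * x r $ i"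
      using 0 by simp
    also have "\<dots> = (\<Sum>j\<in>UNIV. A r $ i $ j * (x r $ j - x r $ i))"
      by (simp add: right_diff_distrib sum_subtractf sum_distrib_right)
    also have "\<dots> = (\<Sum>j\<in>UNIV - {i}. A r $ i $ j * (x r $ j - x r $ i))"
      by (subst sum.remove[of _ i]) auto
    finally show "(A r *v x r) \<bullet> axis i 1 = (\<Sum>j\<in>UNIV - {i}. A r $ i $ j * (x r $ j - x r $ i))" .
  qed
  finally show ?thesis by simp
qed

lemma chain_solution_lower_bound:
  assumes A: "continuous_time_chain A" and x: "solution_on A s t x" and "0 \<le> s"
    and "\<And>i. m \<le> x s $ i" and q: "q \<in> {s..t}"
  shows "m \<le> x q $ i"
proof (rule minimum_principle[where C = UNIV and a = "\<lambda>i j r. A r $ i $ j" and z = "\<lambda>i r. x r $ i"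
      and s = s and t = t])
  show "(\<lambda>r. A r $ i $ j) absolutely_integrable_on {s..t}" for i j
    using chain_entries_integrable[OF A \<open>0 \<le> s\<close>] unfolding entries_integrable_def by blast
  show "continuous_on {s..t} (\<lambda>r. x r $ i)" for i
    by (intro continuous_on_component solution_on_continuous[OF x])
  show "x p $ i + integral {p..q} (\<lambda>r. \<Sum>j\<in>UNIV - {i}. A r $ i $ j * (x r $ j - x r $ i)) \<le> x q $ i"
    if "s \<le> p" "p \<le> q" "q \<le> t" for i p q
    using chain_solution_increment[OF A x \<open>0 \<le> s\<close> that] by simp
qed (use assms q chain_nonneg[OF A] in auto)

text \<open>The lower bound is applied to \<open>x\<close> and to its negative, the latter written
  as a linear combination to fit \<open>solution_on_lincomb\<close>.\<close>

lemma chain_solution_abs_bound: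
  assumes A: "continuous_time_chain A" and x: "solution_on A s t x" and "0 \<le> s"
    and c: "\<And>i. \<bar>x s $ i\<bar> \<le> c" and q: "q \<in> {s..t}"
  shows "\<bar>x q $ i\<bar> \<le> c"
proof -
  have "- c \<le> x q $ i"
    using c by (intro chain_solution_lower_bound[OF A x \<open>0 \<le> s\<close> _ q]) (auto simp: abs_le_iff minus_le_iff)
  moreover have "- c \<le> ((- 1) *\<^sub>R x q + 0 *\<^sub>R x q) $ i"
    using c by (intro chain_solution_lower_bound[OF A solution_on_lincomb[OF x x] \<open>0 \<le> s\<close> _ q])
      (auto simp: abs_le_iff)
  ultimately show ?thesis by simp
qed

text \<open>The corrected entries \<open>z i\<close> obey the minimum principle on \<open>C\<close>
  and so stay above \<open>c\<close>, while the correction never exceeds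
  \<open>c / 2\<close>.\<close>

lemma chain_solution_persists:
  assumes A: "continuous_time_chain A" and x: "solution_on A s t x" and "0 \<le> s" "s \<le> t"
    and c: "\<And>i. \<bar>x s $ i\<bar> \<le> c" "\<And>i. i \<in> C \<Longrightarrow> x s $ i = c"
    and inflow: "integral {s..t} (\<lambda>r. \<Sum>i\<in>C. \<Sum>j\<in>-C. A r $ i $ j) \<le> 1/4"
    and "i \<in> C"
  shows "c / 2 \<le> x t $ i"
proof -
  define d where "d r = (\<Sum>i\<in>C. \<Sum>j\<in>-C. A r $ i $ j)" for r
  define D where "D q = integral {s..q} d" for q
  \<comment> \<open>The correction \<open>2 * c * D\<close> absorbs the influence from outside \<open>C\<close>, since solution entries
    differ by at most \<open>2 * c\<close>.\<close>
  define z where "z i r = x r $ i + 2 * c * D r" for i r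
  have "0 \<le> c" using c(1)[of i] by simp
  have Aij: "(\<lambda>r. A r $ i $ j) absolutely_integrable_on {s..t}" for i j
    using chain_entries_integrable[OF A \<open>0 \<le> s\<close>] unfolding entries_integrable_def by blast
  have di: "d integrable_on {s..t}"
    unfolding d_def[abs_def]
    by (intro set_lebesgue_integral_eq_integral(1) absolutely_integrable_sum Aij) auto
  note xc = continuous_on_component[OF solution_on_continuous[OF x]]
  have "c \<le> z i t"
  proof (rule minimum_principle[where C = C and a = "\<lambda>i j r. A r $ i $ j" and z = z and i = i and q = t
        and s = s and t = t])
    show "continuous_on {s..t} (z i)" for i
      unfolding z_def[abs_def] D_def
      by (intro continuous_intros xc indefinite_integral_continuous_1 di)
    show "c \<le> z i s" if "i \<in> C" for i
      using c(2)[OF that] by (simp add: z_def D_def)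
    fix i p q assume i: "i \<in> C" and pq: "s \<le> p" "p \<le> q" "q \<le> t"
    then have sub: "{p..q} \<subseteq> {s..t}" by auto
    have dpq: "d integrable_on {p..q}" using di sub by (rule integrable_on_subinterval)
    have Fi: "(\<lambda>r. \<Sum>j\<in>S. A r $ i $ j * (x r $ j - x r $ i)) integrable_on {p..q}" for S
      by (intro set_lebesgue_integral_eq_integral(1) absolutely_integrable_sum
            absolutely_integrable_mult_continuous absolutely_integrable_on_subinterval[OF Aij sub]
            continuous_intros continuous_on_subset[OF xc sub]) auto
    \<comment> \<open>The correction is the same for every index, so it cancels in the
      differences.\<close>
    have "integral {p..q} (\<lambda>r. \<Sum>j\<in>C - {i}. A r $ i $ j * (z j r - z i r))
        = integral {p..q} (\<lambda>r. \<Sum>j\<in>C - {i}. A r $ i $ j * (x r $ j - x r $ i))"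
      by (simp add: z_def)
    also have "\<dots> \<le> integral {p..q} (\<lambda>r. (\<Sum>j\<in>UNIV - {i}. A r $ i $ j * (x r $ j - x r $ i)) + 2 * c * d r)"
    proof (rule integral_le)
      show "(\<lambda>r. (\<Sum>j\<in>UNIV - {i}. A r $ i $ j * (x r $ j - x r $ i)) + 2 * c * d r) integrable_on {p..q}"
        by (intro integrable_add Fi integrable_on_mult_right dpq)
      fix r assume "r \<in> {p..q}"
      then have r: "r \<in> {s..t}" "0 \<le> r" using sub \<open>0 \<le> s\<close> by auto
      have inflow_nonneg: "0 \<le> A r $ k $ j" if "k \<in> C" "j \<in> -C" for k j
        by (rule chain_nonneg[OF A r(2)]) (use that in auto)
      \<comment> \<open>The row \<open>i\<close> alone accounts for at most the total inflow
        \<open>d r\<close>, and each outside neighbour pulls down by at most \<open>2 * c\<close>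
        times its weight.\<close>
      have "- (2 * c * d r) \<le> - (2 * c) * (\<Sum>j\<in>-C. A r $ i $ j)"
      proof -
        have "(\<Sum>j\<in>-C. A r $ i $ j) \<le> d r"
          unfolding d_def using i inflow_nonneg
          by (intro member_le_sum[where f = "\<lambda>i. \<Sum>j\<in>-C. A r $ i $ j"] sum_nonneg) auto
        then show ?thesis using \<open>0 \<le> c\<close> by (simp add: mult_left_mono)
      qed
      also have "\<dots> = (\<Sum>j\<in>-C. A r $ i $ j * (- (2 * c)))"
        by (simp add: sum_distrib_left sum_negf algebra_simps)
      also have "\<dots> \<le> (\<Sum>j\<in>-C. A r $ i $ j * (x r $ j - x r $ i))"
      proof (intro sum_mono mult_left_mono)
        show "0 \<le> A r $ i $ j" if "j \<in> -C" for j
          using i that by (rule inflow_nonneg)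
        fix j
        show "- (2 * c) \<le> x r $ j - x r $ i"
          using chain_solution_abs_bound[OF A x \<open>0 \<le> s\<close> c(1) r(1), of i]
            chain_solution_abs_bound[OF A x \<open>0 \<le> s\<close> c(1) r(1), of j] by (simp add: abs_le_iff)
      qed
      also have "(\<Sum>j\<in>-C. A r $ i $ j * (x r $ j - x r $ i))
        = (\<Sum>j\<in>UNIV - {i}. A r $ i $ j * (x r $ j - x r $ i))
          - (\<Sum>j\<in>C - {i}. A r $ i $ j * (x r $ j - x r $ i))"
      proof -
        have "UNIV - {i} = (C - {i}) \<union> -C" "(C - {i}) \<inter> -C = {}" using i by auto
        then show ?thesis by (simp add: sum.union_disjoint)
      qed
      finally show "(\<Sum>j\<in>C - {i}. A r $ i $ j * (x r $ j - x r $ i))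
        \<le> (\<Sum>j\<in>UNIV - {i}. A r $ i $ j * (x r $ j - x r $ i)) + 2 * c * d r" by simp
    qed (rule Fi)
    also have "\<dots> = integral {p..q} (\<lambda>r. \<Sum>j\<in>UNIV - {i}. A r $ i $ j * (x r $ j - x r $ i))
        + 2 * c * integral {p..q} d"
      by (subst integral_add) (auto intro!: Fi integrable_on_mult_right dpq)
    also have "integral {p..q} d = D q - D p"
      using Henstock_Kurzweil_Integration.integral_combine[of s p q d] pq
        integrable_on_subinterval[OF di, of s q] by (auto simp: D_def)
    finally show "z i p + integral {p..q} (\<lambda>r. \<Sum>j\<in>C - {i}. A r $ i $ j * (z j r - z i r)) \<le> z i q"
      using chain_solution_increment[OF A x \<open>0 \<le> s\<close> pq, of i] by (simp add: z_def algebra_simps)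
  qed (use assms Aij chain_nonneg[OF A] in auto)
  \<comment> \<open>Here the bound 1/4 on the inflow pays off: the correction at time
    \<open>t\<close> is at most \<open>c / 2\<close>.\<close>
  moreover have "2 * c * D t \<le> 2 * c * (1/4)"
    using inflow \<open>0 \<le> c\<close> unfolding D_def d_def[abs_def] by (intro mult_left_mono) auto
  ultimately show ?thesis by (simp add: z_def)
qed

subsection \<open>Source components\<close>

text \<open>The source components are obtained as ancestor sets. Every vertex has an ancestor whose
  own ancestor set is smallest, and such a set is a source component, so one representative per
  component reaches everything.\<close>

lemma source_component_representatives:
  fixes E :: "('a::finite \<times> 'a) set"
  obtains F S where "disjoint F" "{} \<notin> F" "\<And>C i j. C \<in> F \<Longrightarrow> i \<in> C \<Longrightarrow> (j, i) \<in> E \<Longrightarrow> j \<in> C"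
    "s_root E S" "card S = card F"
proof -
  define anc where "anc i = {j. (j, i) \<in> E\<^sup>*}" for i
  \<comment> \<open>\<open>R\<close> consists of the vertices that reach all their ancestors, that
    is, those lying in a source component; for them \<open>anc i\<close> is that component.\<close>
  define R where "R = {i. \<forall>j\<in>anc i. i \<in> anc j}"
  define F where "F = anc ` R"
  define rep where "rep C = (SOME i. i \<in> C)" for C :: "'a set"
  have anc_mono: "anc j \<subseteq> anc i" if "j \<in> anc i" for i j
    using that by (auto simp: anc_def)
  have anc_eq: "anc j = anc i" if "i \<in> R" "j \<in> anc i" for i j
    using that anc_mono by (auto simp: R_def)
  have refl: "i \<in> anc i" for i by (simp add: anc_def)
  have ne: "{} \<notin> F" using refl by (auto simp: F_def)
  have disj: "disjoint F"
  proof (rule disjointI)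
    fix C D assume "C \<in> F" "D \<in> F" "C \<noteq> D"
    then obtain i j where "i \<in> R" "j \<in> R" "C = anc i" "D = anc j" by (auto simp: F_def)
    then show "C \<inter> D = {}"
      using anc_eq[of i] anc_eq[of j] \<open>C \<noteq> D\<close> by (metis disjoint_iff)
  qed
  have rep: "rep C \<in> C" if "C \<in> F" for C
    unfolding rep_def using that ne by (metis ex_in_conv someI_ex)
  have "inj_on rep F"
  proof (rule inj_onI)
    fix C D assume "C \<in> F" "D \<in> F" "rep C = rep D"
    then show "C = D" using disj rep disjointD by (metis disjoint_iff)
  qed
  then have card: "card (rep ` F) = card F" by (rule card_image)
  have "s_root E (rep ` F)"
    unfolding s_root_def
  proof
    fix i
    \<comment> \<open>An ancestor of \<open>r\<close> has its ancestor set inside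
      \<open>anc r\<close>; minimal cardinality forces equality, hence mutual reachability.\<close>
    obtain r where r: "r \<in> anc i" "\<And>j. j \<in> anc i \<Longrightarrow> card (anc r) \<le> card (anc j)"
      using ex_has_least_nat[of "\<lambda>r. r \<in> anc i" i "\<lambda>r. card (anc r)"] refl by blast
    have "r \<in> anc j" if j: "j \<in> anc r" for j
    proof -
      have "anc j = anc r"
        using anc_mono[OF j] anc_mono[OF r(1)] j r(2) by (intro card_seteq) auto
      then show ?thesis using refl by simp
    qed
    then have rR: "r \<in> R" by (auto simp: R_def)
    then have "anc r \<in> F" by (auto simp: F_def)
    then have "rep (anc r) \<in> anc r" by (rule rep)
    then have "(rep (anc r), i) \<in> E\<^sup>*"
      using anc_mono[OF r(1)] by (auto simp: anc_def)
    then show "i \<in> rep ` F \<or> (\<exists>j\<in>rep ` F. (j, i) \<in> E\<^sup>+)"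
      using \<open>anc r \<in> F\<close> by (auto simp: rtrancl_eq_or_trancl)
  qed
  moreover have "j \<in> C" if "C \<in> F" "i \<in> C" "(j, i) \<in> E" for C i j
    using that by (auto simp: F_def anc_def intro: converse_rtrancl_into_rtrancl)
  ultimately show ?thesis
    using that disj ne card by blast
qed

section \<open>Dimension counts\<close>

text \<open>The indicator vectors of the blocks are nonzero and pairwise orthogonal, hence
  independent.\<close>

lemma dim_constant_on_blocks_ge:
  fixes F :: "'n::finite set set"
  assumes "disjoint F" "{} \<notin> F"
  shows "card F \<le> dim {w :: real ^ 'n.
      (\<forall>C\<in>F. \<forall>i\<in>C. \<forall>j\<in>C. w $ i = w $ j) \<and> (\<forall>i. i \<notin> \<Union>F \<longrightarrow> w $ i = 0)}"
    (is "_ \<le> dim ?W")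
proof -
  define ind where "ind C = (\<chi> i. if i \<in> C then 1 else (0::real))" for C :: "'n set"
  have ind_iff: "ind C $ i = (if i \<in> C then 1 else 0)" for C i by (simp add: ind_def)
  have "inj ind"
    by (rule injI) (metis ind_iff set_eqI zero_neq_one)
  have "pairwise orthogonal (ind ` F)"
  proof (rule pairwiseI)
    fix x y assume "x \<in> ind ` F" "y \<in> ind ` F" "x \<noteq> y"
    then obtain C D where CD: "C \<in> F" "D \<in> F" "C \<noteq> D" "x = ind C" "y = ind D" by blast
    then have "C \<inter> D = {}" using assms(1) by (meson disjointD)
    then show "orthogonal x y"
      unfolding orthogonal_def CD inner_vec_def ind_iff by (auto intro!: sum.neutral)
  qed
  moreover have "0 \<notin> ind ` F"
  proof
    assume "0 \<in> ind ` F"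
    then obtain C where C: "C \<in> F" "ind C = 0" by auto
    then obtain i where "i \<in> C" using assms(2) by fastforce
    then show False using C ind_iff[of C i] by simp
  qed
  ultimately have "independent (ind ` F)" by (rule pairwise_orthogonal_independent)
  moreover have "ind ` F \<subseteq> ?W"
  proof safe
    fix C D i j assume "C \<in> F" "D \<in> F" "i \<in> D" "j \<in> D"
    then show "ind C $ i = ind C $ j"
      using disjointD[OF assms(1), of C D] by (auto simp: ind_iff)
  next
    fix C i assume "C \<in> F" "i \<notin> \<Union>F"
    then show "ind C $ i = 0" by (auto simp: ind_iff)
  qed
  ultimately have "card (ind ` F) \<le> dim ?W"
    by (intro independent_card_le_dim)
  then show ?thesis
    using card_image[OF inj_on_subset[OF \<open>inj ind\<close> subset_UNIV], of F] by simp
qed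

lemma dim_add_le_DIM:
  fixes S T :: "'a::euclidean_space set"
  assumes "S \<inter> T \<subseteq> {0}" "subspace T" "subspace S"
  shows "dim S + dim T \<le> DIM('a)"
proof -
  have "dim (S \<inter> T) = 0" using assms(1) by (simp only: dim_eq_0)
  then have "dim S + dim T = dim {x + y |x y. x \<in> S \<and> y \<in> T}"
    using dim_sums_Int[OF assms(3,2)] by linarith
  also have "\<dots> \<le> DIM('a)" by (rule dim_subset_UNIV)
  finally show ?thesis .
qed

subsection \<open>The rank bound\<close>

text \<open>A bridge from the extended-valued Lebesgue integral that defines the links to the gauge
  integral used for solutions.\<close>

lemma bounded_integral_if_nn_integral_finite:
  fixes f :: "real \<Rightarrow> real"
  assumes int: "\<And>t. f integrable_on {0..t}" and nonneg: "\<And>r. 0 \<le> r \<Longrightarrow> 0 \<le> f r"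
    and fin: "(\<integral>\<^sup>+t\<in>{0..}. ennreal (f t) \<partial>lebesgue) \<noteq> \<infinity>"
  shows "\<exists>B. \<forall>t. integral {0..t} f \<le> B"
proof -
  let ?N = "\<integral>\<^sup>+t\<in>{0..}. ennreal (f t) \<partial>lebesgue"
  have "integral {0..t} f \<le> enn2real ?N" for t
  proof -
    have "ennreal (integral {0..t} f) = (\<integral>\<^sup>+x\<in>{0..t}. ennreal (f x) \<partial>lborel)"
      using nonneg by (intro nn_integral_has_integral_lebesgue'[symmetric] integrable_integral int) auto
    also have "\<dots> = (\<integral>\<^sup>+x\<in>{0..t}. ennreal (f x) \<partial>lebesgue)"
      by (rule nn_integral_completion[symmetric])
    also have "\<dots> \<le> ?N"
      by (intro nn_integral_mono) (auto simp: indicator_def)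
    also have "\<dots> = ennreal (enn2real ?N)"
      using fin by (simp add: top.not_eq_extremum)
    finally show ?thesis
      by (simp add: ennreal_le_iff)
  qed
  then show ?thesis by blast
qed

text \<open>At a time where the integral from 0 is within \<epsilon> of its supremum, later times
  can add at most \<epsilon>.\<close>

lemma tail_integral_small:
  fixes f :: "real \<Rightarrow> real"
  assumes int: "\<And>t. f integrable_on {0..t}" and B: "\<And>t. integral {0..t} f \<le> B" and "\<epsilon> > 0"
  shows "\<exists>\<tau>\<ge>0. \<forall>t\<ge>\<tau>. integral {\<tau>..t} f \<le> \<epsilon>"
proof -
  let ?F = "\<lambda>t. integral {0..t} f"
  have bdd: "bdd_above (?F ` {0..})" using B by (auto simp: bdd_above_def)
  have "(SUP t\<in>{0..}. ?F t) - \<epsilon> < (SUP t\<in>{0..}. ?F t)" using \<open>\<epsilon> > 0\<close> by simp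
  then obtain \<tau> where \<tau>: "\<tau> \<ge> 0" "(SUP t\<in>{0..}. ?F t) - \<epsilon> < ?F \<tau>"
    using less_cSUP_iff[OF _ bdd] by auto
  have "integral {\<tau>..t} f \<le> \<epsilon>" if "t \<ge> \<tau>" for t
  proof -
    have "?F \<tau> + integral {\<tau>..t} f = ?F t"
      using \<tau> that by (intro Henstock_Kurzweil_Integration.integral_combine int) auto
    moreover have "?F t \<le> (SUP t\<in>{0..}. ?F t)"
      using \<tau> that by (intro cSUP_upper bdd) auto
    ultimately show ?thesis using \<tau> by linarith
  qed
  then show ?thesis using \<tau> by blast
qed

text \<open>One \<tau> serves all sets \<open>C\<close> without incoming links: the inflow into each
  is a partial sum of \<open>d\<close>, the sum of all off-diagonal entries with finite
  integral.\<close>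

lemma eventually_small_inflow:
  fixes A :: "real \<Rightarrow> real ^ 'n ^ 'n"
  assumes A: "continuous_time_chain A"
  obtains \<tau> where "0 \<le> \<tau>"
    "\<And>C t. (\<And>i j. i \<in> C \<Longrightarrow> (j, i) \<in> unbounded_interactions A \<Longrightarrow> j \<in> C) \<Longrightarrow> \<tau> \<le> t \<Longrightarrow>
      integral {\<tau>..t} (\<lambda>r. \<Sum>i\<in>C. \<Sum>j\<in>-C. A r $ i $ j) \<le> 1/4"
proof -
  \<comment> \<open>Pairs in \<open>P\<close> are ordered as matrix indices, so the corresponding
    link is the swapped pair.\<close>
  define P where "P = {(i, j). i \<noteq> j \<and> (j, i) \<notin> unbounded_interactions A}"
  have int: "(\<lambda>r. A r $ i $ j) integrable_on {s..t}" if "0 \<le> s" for i j s t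
    using chain_entries_integrable[OF A that] unfolding entries_integrable_def
    by (blast intro: set_lebesgue_integral_eq_integral(1))
  have "\<exists>B. \<forall>t. integral {0..t} (\<lambda>r. A r $ fst p $ snd p) \<le> B" if "p \<in> P" for p
    using that chain_nonneg[OF A]
    by (intro bounded_integral_if_nn_integral_finite int) (auto simp: P_def unbounded_interactions_def)
  then obtain B where B: "\<And>p t. p \<in> P \<Longrightarrow> integral {0..t} (\<lambda>r. A r $ fst p $ snd p) \<le> B p"
    by metis
  define d where "d r = (\<Sum>p\<in>P. A r $ fst p $ snd p)" for r
  have d_int: "d integrable_on {s..t}" if "0 \<le> s" for s t
    unfolding d_def[abs_def] using that by (intro integrable_sum int) auto
  have "integral {0..t} d \<le> sum B P" for t
    unfolding d_def[abs_def] using B by (subst integral_sum) (auto intro!: sum_mono int)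
  then obtain \<tau> where \<tau>: "\<tau> \<ge> 0" "\<And>t. t \<ge> \<tau> \<Longrightarrow> integral {\<tau>..t} d \<le> 1/4"
    using tail_integral_small[of d "sum B P" "1/4"] d_int by auto
  show ?thesis
  proof (rule that[OF \<tau>(1)])
    fix C t assume C: "\<And>i j. i \<in> C \<Longrightarrow> (j, i) \<in> unbounded_interactions A \<Longrightarrow> j \<in> C" and "\<tau> \<le> t"
    have "integral {\<tau>..t} (\<lambda>r. \<Sum>i\<in>C. \<Sum>j\<in>-C. A r $ i $ j) \<le> integral {\<tau>..t} d"
    proof (rule integral_le)
      show "(\<lambda>r. \<Sum>i\<in>C. \<Sum>j\<in>-C. A r $ i $ j) integrable_on {\<tau>..t}"
        by (intro integrable_sum int \<tau>) auto
      fix r assume "r \<in> {\<tau>..t}"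
      then have "0 \<le> r" using \<tau> by auto
      have "(\<Sum>i\<in>C. \<Sum>j\<in>-C. A r $ i $ j) = (\<Sum>p\<in>C \<times> -C. A r $ fst p $ snd p)"
        by (simp add: sum.cartesian_product case_prod_unfold)
      also have "\<dots> \<le> d r"
        unfolding d_def using C chain_nonneg[OF A \<open>0 \<le> r\<close>]
        by (intro sum_mono2) (auto simp: P_def)
      finally show "(\<Sum>i\<in>C. \<Sum>j\<in>-C. A r $ i $ j) \<le> d r" .
    qed (use d_int \<tau> in auto)
    then show "integral {\<tau>..t} (\<lambda>r. \<Sum>i\<in>C. \<Sum>j\<in>-C. A r $ i $ j) \<le> 1/4"
      using \<tau>(2)[OF \<open>\<tau> \<le> t\<close>] by linarith
  qed
qed

text \<open>After a change of sign the solution equals its maximal absolute value on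
  \<open>C\<close>; by persistence coordinate \<open>i\<close> keeps at least half of it, which is
  compatible with convergence to 0 only if it is 0.\<close>

lemma persistent_solution_not_null:
  fixes A :: "real \<Rightarrow> real ^ 'n ^ 'n"
  assumes A: "continuous_time_chain A" and "0 \<le> \<tau>" and x: "is_solution A \<tau> x"
    and inflow: "\<And>t. \<tau> \<le> t \<Longrightarrow> integral {\<tau>..t} (\<lambda>r. \<Sum>i\<in>C. \<Sum>j\<in>-C. A r $ i $ j) \<le> 1/4"
    and const: "\<And>j. j \<in> C \<Longrightarrow> x \<tau> $ j = x \<tau> $ i" and "i \<in> C"
    and max: "\<And>j. \<bar>x \<tau> $ j\<bar> \<le> \<bar>x \<tau> $ i\<bar>"
    and lim: "(x \<longlongrightarrow> 0) at_top"
  shows "x \<tau> $ i = 0"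
proof -
  \<comment> \<open>If \<open>x \<tau> $ i\<close> is 0, then \<sigma> is 0 as well and the bounds
    below hold trivially.\<close>
  define \<sigma> where "\<sigma> = sgn (x \<tau> $ i)"
  have \<sigma>: "\<sigma> * x \<tau> $ i = \<bar>x \<tau> $ i\<bar>" "\<bar>\<sigma>\<bar> \<le> 1" by (auto simp: \<sigma>_def abs_sgn abs_sgn_eq mult.commute)
  define y where "y r = \<sigma> *\<^sub>R x r + 0 *\<^sub>R x r" for r
  have y_nth: "y r $ j = \<sigma> * x r $ j" for r j by (simp add: y_def)
  have y: "is_solution A \<tau> y" unfolding y_def[abs_def] by (rule is_solution_lincomb[OF x x])
  have "\<bar>x \<tau> $ i\<bar> / 2 \<le> y t $ i" if t: "\<tau> \<le> t" for t
  proof (rule chain_solution_persists[OF A _ \<open>0 \<le> \<tau>\<close> t, where C = C])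
    show "solution_on A \<tau> t y" using y t by (simp add: is_solution_iff)
    fix j
    have "\<bar>y \<tau> $ j\<bar> \<le> 1 * \<bar>x \<tau> $ j\<bar>"
      unfolding y_nth abs_mult using \<sigma>(2) by (intro mult_right_mono) auto
    then show "\<bar>y \<tau> $ j\<bar> \<le> \<bar>x \<tau> $ i\<bar>" using max[of j] by simp
  next
    fix j assume "j \<in> C"
    then show "y \<tau> $ j = \<bar>x \<tau> $ i\<bar>" by (simp add: y_nth const \<sigma>(1))
  qed (use inflow[OF t] \<open>i \<in> C\<close> in auto)
  moreover have "((\<lambda>t. y t $ i) \<longlongrightarrow> 0) at_top"
    unfolding y_nth using tendsto_vec_nth[OF lim, of i] by (intro tendsto_mult_right_zero) simp
  ultimately have "\<bar>x \<tau> $ i\<bar> / 2 \<le> 0"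
    by (intro tendsto_lowerbound[of "\<lambda>t. y t $ i" 0 at_top])
      (auto simp: eventually_at_top_linorder)
  then show ?thesis by simp
qed

lemma subspace_null_space: "subspace (null_space A \<tau>)"
  unfolding null_space_def
proof (rule subspaceI)
  fix x y c
  assume x: "x \<in> {v. ((\<lambda>t. state_transition A t \<tau> *v v) \<longlongrightarrow> 0) at_top}"
  then show "c *\<^sub>R x \<in> {v. ((\<lambda>t. state_transition A t \<tau> *v v) \<longlongrightarrow> 0) at_top}"
    using tendsto_scaleR[OF tendsto_const, of "\<lambda>t. state_transition A t \<tau> *v x" 0 at_top c]
    by (simp add: matrix_vector_mult_scaleR)
  assume "y \<in> {v. ((\<lambda>t. state_transition A t \<tau> *v v) \<longlongrightarrow> 0) at_top}"
  then show "x + y \<in> {v. ((\<lambda>t. state_transition A t \<tau> *v v) \<longlongrightarrow> 0) at_top}"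
    using x tendsto_add[of "\<lambda>t. state_transition A t \<tau> *v x" 0 at_top "\<lambda>t. state_transition A t \<tau> *v y" 0]
    by (simp add: matrix_vector_right_distrib)
next
  show "0 \<in> {v. ((\<lambda>t. state_transition A t \<tau> *v v) \<longlongrightarrow> 0) at_top}"
    by (simp only: mem_Collect_eq matrix_vector_mult_0_right tendsto_const)
qed

lemma is_solution_restart:
  assumes "is_solution A s x" "s \<le> \<tau>"
  shows "is_solution A \<tau> x"
  unfolding is_solution_iff
proof (intro allI impI)
  fix t assume t: "\<tau> \<le> t"
  show "solution_on A \<tau> t x"
    by (rule solution_on_subinterval[of A s t]) (use assms t in \<open>auto simp: is_solution_iff\<close>)
qed

theorem theorem3:
  fixes A :: "real \<Rightarrow> real ^ 'n ^ 'n"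
  assumes "continuous_time_chain A"
  shows "chain_rank A \<ge> Min {card S | S. s_root (unbounded_interactions A) S}"
proof -
  let ?E = "unbounded_interactions A"
  obtain F S where F: "disjoint F" "{} \<notin> F"
    and closed: "\<And>C i j. C \<in> F \<Longrightarrow> i \<in> C \<Longrightarrow> (j, i) \<in> ?E \<Longrightarrow> j \<in> C"
    and S: "s_root ?E S" "card S = card F"
    using source_component_representatives[of ?E] by metis
  obtain \<tau> where "0 \<le> \<tau>" and inflow:
    "\<And>C t. (\<And>i j. i \<in> C \<Longrightarrow> (j, i) \<in> ?E \<Longrightarrow> j \<in> C) \<Longrightarrow> \<tau> \<le> t \<Longrightarrow>
      integral {\<tau>..t} (\<lambda>r. \<Sum>i\<in>C. \<Sum>j\<in>-C. A r $ i $ j) \<le> 1/4"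
    using eventually_small_inflow[OF assms] by metis
  note int = chain_entries_integrable[OF assms order.refl]
  have "\<forall>v. \<exists>x. is_solution A 0 x \<and> x 0 = v"
    using is_solution_exists[OF int] by blast
  then obtain X where X: "\<And>v. is_solution A 0 (X v)" "\<And>v. X v 0 = v"
    unfolding choice_iff by blast
  have \<Phi>: "state_transition A t 0 *v v = X v t" if "0 \<le> t" for t v
    using state_transition_solution[OF int that X(1), of v] X(2) by simp
  \<comment> \<open>\<open>T\<close> transports the null space from time 0 to time \<tau>, where the
    inflow is already small; being injective, it preserves the dimension.\<close>
  define T where "T v = state_transition A \<tau> 0 *v v" for v
  have T: "T v = X v \<tau>" for v unfolding T_def using \<Phi>[OF \<open>0 \<le> \<tau>\<close>] .
  have linear_T: "linear T" unfolding T_def[abs_def] by (rule matrix_vector_mul_linear)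
  have "inj T"
  proof (rule injI)
    fix u v assume "T u = T v"
    then have "X u 0 = X v 0"
      unfolding T by (rule is_solution_unique[OF int X(1) X(1) _ \<open>0 \<le> \<tau>\<close> order.refl])
    then show "u = v" using X(2) by simp
  qed
  let ?N = "null_space A 0"
  let ?W = "{w :: real ^ 'n. (\<forall>C\<in>F. \<forall>i\<in>C. \<forall>j\<in>C. w $ i = w $ j) \<and> (\<forall>i. i \<notin> \<Union>F \<longrightarrow> w $ i = 0)}"
  \<comment> \<open>It suffices to treat a coordinate of largest absolute value. Outside all
    components it vanishes by definition of \<open>?W\<close>; inside one, its maximality is the
    global bound that the persistence argument needs.\<close>
  have "T ` ?N \<inter> ?W \<subseteq> {0}"
  proof safe
    fix v assume v: "v \<in> ?N" and const: "\<forall>C\<in>F. \<forall>i\<in>C. \<forall>j\<in>C. T v $ i = T v $ j"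
      and zero: "\<forall>i. i \<notin> \<Union>F \<longrightarrow> T v $ i = 0"
    have "eventually (\<lambda>t. state_transition A t 0 *v v = X v t) at_top"
      using eventually_ge_at_top[of 0] by eventually_elim (rule \<Phi>)
    moreover have "((\<lambda>t. state_transition A t 0 *v v) \<longlongrightarrow> 0) at_top"
      using v by (simp add: null_space_def)
    ultimately have lim: "(X v \<longlongrightarrow> 0) at_top" using tendsto_cong by fastforce
    have "Max (range (\<lambda>j. \<bar>T v $ j\<bar>)) \<in> range (\<lambda>j. \<bar>T v $ j\<bar>)" by (intro Max_in) auto
    then obtain i where i: "Max (range (\<lambda>j. \<bar>T v $ j\<bar>)) = \<bar>T v $ i\<bar>" by blast
    have max: "\<bar>T v $ j\<bar> \<le> \<bar>T v $ i\<bar>" for j unfolding i[symmetric] by (rule Max_ge) auto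
    have "T v $ i = 0"
    proof (cases "i \<in> \<Union>F")
      case True
      then obtain C where C: "C \<in> F" "i \<in> C" by blast
      show ?thesis
        unfolding T
      proof (rule persistent_solution_not_null[OF assms \<open>0 \<le> \<tau>\<close> _ _ _ C(2) _ lim])
        show "is_solution A \<tau> (X v)" using X(1) \<open>0 \<le> \<tau>\<close> by (rule is_solution_restart)
        show "X v \<tau> $ j = X v \<tau> $ i" if "j \<in> C" for j using const C that unfolding T by blast
        show "\<bar>X v \<tau> $ j\<bar> \<le> \<bar>X v \<tau> $ i\<bar>" for j using max unfolding T .
      qed (use inflow closed[OF C(1)] in blast)
    qed (use zero in blast)
    then show "T v = 0" using max by (simp add: vec_eq_iff)
  qed
  moreover have "subspace ?W"
  proof (rule subspaceI)
    fix w w' assume w: "w \<in> ?W" and w': "w' \<in> ?W"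
    show "w + w' \<in> ?W"
    proof (intro CollectI conjI ballI allI impI)
      fix C i j assume "C \<in> F" "i \<in> C" "j \<in> C"
      then have "w $ i = w $ j" "w' $ i = w' $ j" using w w' by blast+
      then show "(w + w') $ i = (w + w') $ j" by simp
    qed (use w w' in simp)
  next
    fix c w assume w: "w \<in> ?W"
    show "c *\<^sub>R w \<in> ?W"
    proof (intro CollectI conjI ballI allI impI)
      fix C i j assume "C \<in> F" "i \<in> C" "j \<in> C"
      then have "w $ i = w $ j" using w by blast
      then show "(c *\<^sub>R w) $ i = (c *\<^sub>R w) $ j" by simp
    qed (use w in simp)
  qed simp
  moreover have "subspace (T ` ?N)"
    by (rule linear_subspace_image[OF linear_T subspace_null_space])
  ultimately have "dim (T ` ?N) + dim ?W \<le> DIM(real ^ 'n)"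
    by (intro dim_add_le_DIM)
  moreover have "dim (T ` ?N) = nullity A"
    unfolding nullity_def
    by (rule dim_image_eq[OF linear_T inj_on_subset[OF \<open>inj T\<close> subset_UNIV]])
  moreover have "card F \<le> dim ?W" by (rule dim_constant_on_blocks_ge[OF F])
  \<comment> \<open>The dimension inequality also shows that \<open>nullity A\<close> is at most
    \<open>CARD('n)\<close>, so the subtraction of naturals in \<open>chain_rank\<close> does not
    truncate.\<close>
  ultimately have "card F \<le> chain_rank A"
    unfolding chain_rank_def by simp
  moreover have "Min {card S | S. s_root ?E S} \<le> card S"
    using S(1) by (intro Min_le) auto
  ultimately show ?thesis using S(2) by simp
qed

end
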